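(* Suppose the features $f:\mathsf{Z}\to\underline{\mathbb{R}}^p$, the test functions $h:\mathsf{Z}\to\underline{\mathbb{R}}^q$ and the samples $\{z_i=(x_i,u_i),x_i^+,r_i\}_{i\in[1:n]}$ satisfy: (1) for every $z\in\mathsf{Z}$ there exists $j\in[1:p]$ with $[f]_j(z)\neq-\infty$; (2) for every $j\in[1:p]$ there exists $i\in[1:n]$ with $[f]_j(z_i)\neq-\infty$; (3) for every $z\in\mathsf{Z}$ there exists $k\in[1:q]$ with $[h]_k(z)\neq-\infty$; (4) for every $k\in[1:q]$ there exists $i\in[1:n]$ with $[h]_k(z_i)\neq-\infty$. Then the operator $\mathbf{D}^{H}:\mathbb{R}^p\to\mathbb{R}^p$ defined by $$\mathbf{D}^{H}\theta=-\left[(F_{\mathrm{s}}^{H})^{\top}\boxtimes\big[-\big(G_{\mathrm{s}}^{H}\boxtimes(\gamma\theta)\big)\big]\right]$$ is a $\gamma$-contraction in the $\infty$-norm, i.e., $\|\mathbf{D}^{H}\theta_1-\mathbf{D}^{H}\theta_2\|_\infty\le\gamma\|\theta_1-\theta_2\|_\infty$ for all $\theta_1,\theta_2\in\mathbb{R}^p$.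
   Context: Notation: $\underline{\mathbb{R}}=\mathbb{R}\cup\{-\infty\}$ with the usual conventions ($-\infty+a=-\infty$, $\gamma\cdot(-\infty)=-\infty$); $[1:n]=\{1,\dots,n\}$; $[v]_i$ and $[M]_{i,j}$ denote entries. For $A\in\underline{\mathbb{R}}^{n\times m}$, $B\in\underline{\mathbb{R}}^{m\times p}$, the max-plus product $A\boxtimes B\in\underline{\mathbb{R}}^{n\times p}$ has entries $[A\boxtimes B]_{i,j}=\max_{k\in[1:m]}\{[A]_{i,k}+[B]_{k,j}\}$; the notation applies to vectors as one-column matrices. $\gamma\theta$ and $-v$ denote ordinary scalar multiplication and negation. Setting: $\mathsf{Z}=\mathsf{X}\times\mathsf{U}$ where $\mathsf{X}\subset\mathbb{R}^{d_{\mathrm{x}}}$, $\mathsf{U}\subset\mathbb{R}^{d_{\mathrm{u}}}$ are nonempty state and action spaces; $\gamma\in(0,1)$ is the discount factor. The data are $n\in\mathbb{N}$ samples $\{z_i=(x_i,u_i),x_i^+,r_i\}_{i\in[1:n]}$ with $z_i\in\mathsf{Z}$, $x_i^+\in\mathsf{X}$, $r_i\in\mathbb{R}$. For $Q:\mathsf{Z}\to\underline{\mathbb{R}}$ the empirical Bellman operator is $\mathbf{B}_{\mathrm{s}}Q(z_i)=r_i+\gamma\max_{u^+\in\mathsf{U}}Q(x_i^+,u^+)$, $i\in[1:n]$. The maxima over $u^+$ of the features are assumed to exist in $\underline{\mathbb{R}}$. The matrices $F_{\mathrm{s}},G_{\mathrm{s}}\in\underline{\mathbb{R}}^{n\times p}$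 and $H_{\mathrm{s}}\in\underline{\mathbb{R}}^{n\times q}$ have entries $[F_{\mathrm{s}}]_{i,j}=[f]_j(z_i)$, $[G_{\mathrm{s}}]_{i,j}=\mathbf{B}_{\mathrm{s}}[f]_j(z_i)$, $[H_{\mathrm{s}}]_{i,k}=[h]_k(z_i)$, and $F_{\mathrm{s}}^{H}=H_{\mathrm{s}}^\top\boxtimes F_{\mathrm{s}}$, $G_{\mathrm{s}}^{H}=H_{\mathrm{s}}^\top\boxtimes G_{\mathrm{s}}$, both in $\underline{\mathbb{R}}^{q\times p}$. *)

theory Defs
  imports "HOL-Analysis.Analysis"
begin

text \<open>
  The max-plus numbers (the reals extended by minus infinity) are rendered as the values of
  type \<^typ>\<open>ereal\<close> different from \<open>\<infinity>\<close>; data ranging over them carry a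
  hypothesis \<open>\<noteq> \<infinity>\<close>. On these values addition and multiplication by a positive real
  follow the usual max-plus conventions.
\<close>

definition mp_mult :: "ereal^'m^'n \<Rightarrow> ereal^'p^'m \<Rightarrow> ereal^'p^'n"  (infixl "\<boxtimes>" 70)
  where "A \<boxtimes> B = (\<chi> i j. Max (range (\<lambda>k. A $ i $ k + B $ k $ j)))"

definition mp_mult_vec :: "ereal^'m^'n \<Rightarrow> ereal^'m \<Rightarrow> ereal^'n"  (infixr "\<boxtimes>\<^sub>v" 70)
  where "A \<boxtimes>\<^sub>v b = (\<chi> i. Max (range (\<lambda>k. A $ i $ k + b $ k)))"

definition ereal_vec :: "real^'p \<Rightarrow> ereal^'p"
  where "ereal_vec v = (\<chi> j. ereal (v $ j))"

text \<open>
  The maximum over the action set, which may be infinite, is written as a supremum; it is a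
  maximum precisely when it is attained, which is required as a separate hypothesis wherever
  the operator is used.
\<close>

definition emp_bellman ::
    "real \<Rightarrow> 'u set \<Rightarrow> ('n \<Rightarrow> 'x) \<Rightarrow> ('n \<Rightarrow> real) \<Rightarrow> ('x \<times> 'u \<Rightarrow> ereal) \<Rightarrow> 'n \<Rightarrow> ereal"
  where "emp_bellman \<gamma> U xp r Q i = ereal (r i) + ereal \<gamma> * (SUP up\<in>U. Q (xp i, up))"

definition F_s :: "('x \<times> 'u \<Rightarrow> ereal^'p) \<Rightarrow> ('n \<Rightarrow> 'x \<times> 'u) \<Rightarrow> ereal^'p^'n"
  where "F_s f z = (\<chi> i j. f (z i) $ j)"

definition G_s ::
    "real \<Rightarrow> 'u set \<Rightarrow> ('n \<Rightarrow> 'x) \<Rightarrow> ('n \<Rightarrow> real) \<Rightarrow> ('x \<times> 'u \<Rightarrow> ereal^'p) \<Rightarrow> ereal^'p^'n"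
  where "G_s \<gamma> U xp r f = (\<chi> i j. emp_bellman \<gamma> U xp r (\<lambda>z. f z $ j) i)"

definition H_s :: "('x \<times> 'u \<Rightarrow> ereal^'q) \<Rightarrow> ('n \<Rightarrow> 'x \<times> 'u) \<Rightarrow> ereal^'q^'n"
  where "H_s h z = (\<chi> i k. h (z i) $ k)"

definition FH_s ::
    "('x \<times> 'u \<Rightarrow> ereal^'p) \<Rightarrow> ('x \<times> 'u \<Rightarrow> ereal^'q) \<Rightarrow> ('n::finite \<Rightarrow> 'x \<times> 'u) \<Rightarrow> ereal^'p^'q"
  where "FH_s f h z = transpose (H_s h z) \<boxtimes> F_s f z"

definition GH_s ::
    "real \<Rightarrow> 'u set \<Rightarrow> ('x \<times> 'u \<Rightarrow> ereal^'p) \<Rightarrow> ('x \<times> 'u \<Rightarrow> ereal^'q) \<Rightarrow> ('n::finite \<Rightarrow> 'x \<times> 'u)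
      \<Rightarrow> ('n \<Rightarrow> 'x) \<Rightarrow> ('n \<Rightarrow> real) \<Rightarrow> ereal^'p^'q"
  where "GH_s \<gamma> U f h z xp r = transpose (H_s h z) \<boxtimes> G_s \<gamma> U xp r f"

text \<open>
  The operator as given by its formula, with values in \<^typ>\<open>ereal^'p\<close>; that these values
  are real vectors is a claim to be proved.
\<close>

definition DH ::
    "real \<Rightarrow> 'u set \<Rightarrow> ('x \<times> 'u \<Rightarrow> ereal^'p) \<Rightarrow> ('x \<times> 'u \<Rightarrow> ereal^'q) \<Rightarrow> ('n::finite \<Rightarrow> 'x \<times> 'u)
      \<Rightarrow> ('n \<Rightarrow> 'x) \<Rightarrow> ('n \<Rightarrow> real) \<Rightarrow> real^'p \<Rightarrow> ereal^'p"
  where "DH \<gamma> U f h z xp r \<theta> =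
    - (transpose (FH_s f h z) \<boxtimes>\<^sub>v (- (GH_s \<gamma> U f h z xp r \<boxtimes>\<^sub>v ereal_vec (\<gamma> *\<^sub>R \<theta>))))"

end

theory Submission
  imports Defs
begin

text \<open>
  A max-plus matrix without entry \<open>\<infinity>\<close> and with an entry different from \<open>-\<infinity>\<close>
  in every row maps real vectors to real vectors. The induced map on real vectors is monotone and
  commutes with adding a constant to all coordinates, hence it is nonexpansive for the maximum norm
  (\<open>infnorm_mp_apply_diff_le\<close>). Such matrices are closed under the max-plus product
  (\<open>finite_rows_mp_mult\<close>).

  The four nondegeneracy conditions on the features and the test functions give this property, in
  turn, to the matrices \<open>G\<^sub>s\<close>, \<open>F\<^sub>s\<^sup>T\<close>, \<open>H\<^sub>s\<close> and \<open>H\<^sub>s\<^sup>T\<close>, so \<open>H\<^sub>s\<^sup>T \<boxtimes> G\<^sub>s\<close> and \<open>(H\<^sub>s\<^sup>T \<boxtimes> F\<^sub>s)\<^sup>T = F\<^sub>s\<^sup>T \<boxtimes> H\<^sub>s\<close> have it too.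
  The operator is thus the composition of a scaling by \<open>\<gamma>\<close>, two nonexpansive maps and two
  negations, which are isometries.
\<close>

text \<open>
  A max-plus matrix (no entry \<open>\<infinity>\<close>) each of whose rows contains a finite entry.
\<close>

definition finite_rows :: "ereal^'m^'n \<Rightarrow> bool"
  where "finite_rows A \<longleftrightarrow> (\<forall>i k. A $ i $ k \<noteq> \<infinity>) \<and> (\<forall>i. \<exists>k. A $ i $ k \<noteq> -\<infinity>)"

text \<open>
  The map on real vectors induced by a max-plus matrix. It is meaningful when the matrix has
  finite rows; otherwise infinite coordinates are replaced by \<open>0\<close>.
\<close>

definition mp_apply :: "ereal^'m^'n \<Rightarrow> real^'m \<Rightarrow> real^'n"
  where "mp_apply A v = (\<chi> i. real_of_ereal ((A \<boxtimes>\<^sub>v ereal_vec v) $ i))"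

lemma Max_range_attained:
  fixes g :: "'a::finite \<Rightarrow> 'b::linorder"
  obtains k where "Max (range g) = g k"
proof -
  have "Max (range g) \<in> range g"
    by (rule Max_in) auto
  then show thesis
    using that by blast
qed

lemma Max_range_ge:
  fixes g :: "'a::finite \<Rightarrow> 'b::linorder"
  shows "g k \<le> Max (range g)"
  by simp

lemma finite_rows_mp_mult:
  assumes A: "finite_rows A" and B: "finite_rows B"
  shows "finite_rows (A \<boxtimes> B)"
  unfolding finite_rows_def
proof (intro conjI allI)
  fix i j
  obtain k where "(A \<boxtimes> B) $ i $ j = A $ i $ k + B $ k $ j"
    using Max_range_attained[of "\<lambda>k. A $ i $ k + B $ k $ j"] by (auto simp: mp_mult_def)
  then show "(A \<boxtimes> B) $ i $ j \<noteq> \<infinity>"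
    using A B by (simp add: finite_rows_def)
next
  fix i
  obtain k where k: "A $ i $ k \<noteq> -\<infinity>"
    using A unfolding finite_rows_def by blast
  obtain j where j: "B $ k $ j \<noteq> -\<infinity>"
    using B unfolding finite_rows_def by blast
  have "A $ i $ k + B $ k $ j \<le> (A \<boxtimes> B) $ i $ j"
    unfolding mp_mult_def
    using Max_range_ge[of "\<lambda>k. A $ i $ k + B $ k $ j" k] by simp
  moreover have "A $ i $ k + B $ k $ j \<noteq> -\<infinity>"
    using k j by simp
  ultimately show "\<exists>j. (A \<boxtimes> B) $ i $ j \<noteq> -\<infinity>"
    by (metis ereal_infty_less_eq(2))
qed

lemma transpose_mp_mult: "transpose (A \<boxtimes> B) = transpose B \<boxtimes> transpose A"
  by (simp add: mp_mult_def transpose_def vec_eq_iff add.commute)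

lemma mp_mult_vec_attained:
  obtains k where "(A \<boxtimes>\<^sub>v b) $ i = A $ i $ k + b $ k"
  using Max_range_attained[of "\<lambda>k. A $ i $ k + b $ k"] by (auto simp: mp_mult_vec_def)

lemma mp_mult_vec_ge: "A $ i $ k + b $ k \<le> (A \<boxtimes>\<^sub>v b) $ i"
  unfolding mp_mult_vec_def
  using Max_range_ge[of "\<lambda>k. A $ i $ k + b $ k" k] by simp

lemma ereal_vec_mp_apply:
  assumes "finite_rows A"
  shows "ereal_vec (mp_apply A v) = A \<boxtimes>\<^sub>v ereal_vec v"
proof -
  have "ereal (real_of_ereal ((A \<boxtimes>\<^sub>v ereal_vec v) $ i)) = (A \<boxtimes>\<^sub>v ereal_vec v) $ i" for i
  proof -
    obtain k where "(A \<boxtimes>\<^sub>v ereal_vec v) $ i = A $ i $ k + ereal_vec v $ k"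
      by (rule mp_mult_vec_attained)
    then have "(A \<boxtimes>\<^sub>v ereal_vec v) $ i \<noteq> \<infinity>"
      using assms by (simp add: finite_rows_def ereal_vec_def)
    moreover obtain l where "A $ i $ l \<noteq> -\<infinity>"
      using assms unfolding finite_rows_def by blast
    then have "A $ i $ l + ereal_vec v $ l \<noteq> -\<infinity>"
      by (simp add: ereal_vec_def)
    then have "(A \<boxtimes>\<^sub>v ereal_vec v) $ i \<noteq> -\<infinity>"
      using mp_mult_vec_ge[of A i l "ereal_vec v"] by auto
    ultimately show ?thesis
      by (cases "(A \<boxtimes>\<^sub>v ereal_vec v) $ i") auto
  qed
  then show ?thesis
    by (simp add: mp_apply_def ereal_vec_def vec_eq_iff)
qed

lemma mp_apply_diff_le:
  assumes "finite_rows A"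
  shows "mp_apply A v $ i - mp_apply A w $ i \<le> infnorm (v - w)"
proof -
  have eq: "(A \<boxtimes>\<^sub>v ereal_vec u) $ i = ereal (mp_apply A u $ i)" for u
    unfolding ereal_vec_mp_apply[OF assms, symmetric] by (simp add: ereal_vec_def)
  \<comment> \<open>An index attaining the maximum for \<open>v\<close> also gives a lower bound for the maximum for \<open>w\<close>.\<close>
  obtain k where k: "(A \<boxtimes>\<^sub>v ereal_vec v) $ i = A $ i $ k + ereal_vec v $ k"
    by (rule mp_mult_vec_attained)
  have "A $ i $ k + ereal_vec w $ k \<le> (A \<boxtimes>\<^sub>v ereal_vec w) $ i"
    by (rule mp_mult_vec_ge)
  with k have "mp_apply A v $ i - mp_apply A w $ i \<le> v $ k - w $ k"
    unfolding eq by (cases "A $ i $ k") (auto simp: ereal_vec_def)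
  also have "\<dots> \<le> infnorm (v - w)"
    using component_le_infnorm_cart[of "v - w" k] by simp
  finally show ?thesis .
qed

lemma infnorm_le_cart:
  fixes x :: "real^'n"
  assumes "\<And>i. \<bar>x $ i\<bar> \<le> c"
  shows "infnorm x \<le> c"
  unfolding infnorm_cart using assms by (auto intro!: cSup_least)

lemma infnorm_mp_apply_diff_le:
  assumes "finite_rows A"
  shows "infnorm (mp_apply A v - mp_apply A w) \<le> infnorm (v - w)"
proof (rule infnorm_le_cart)
  fix i
  show "\<bar>(mp_apply A v - mp_apply A w) $ i\<bar> \<le> infnorm (v - w)"
    using mp_apply_diff_le[OF assms, of v i w] mp_apply_diff_le[OF assms, of w i v]
    by (simp add: infnorm_sub)
qed

lemma ereal_vec_uminus: "ereal_vec (- v) = - ereal_vec v"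
  by (simp add: ereal_vec_def vec_eq_iff)

text \<open>
  Attainment of the maximum over the actions is what keeps \<open>\<infinity>\<close> out of the matrix: a
  supremum of values below \<open>\<infinity>\<close> could still be \<open>\<infinity>\<close>.
\<close>

lemma finite_rows_G_s:
  fixes f :: "'x \<times> 'u \<Rightarrow> ereal^'p"
  assumes "U \<noteq> {}" and "0 < \<gamma>"
    and ninf: "\<And>i u j. u \<in> U \<Longrightarrow> f (xp i, u) $ j \<noteq> \<infinity>"
    and att: "\<And>i j. \<exists>u\<in>U. \<forall>up\<in>U. f (xp i, up) $ j \<le> f (xp i, u) $ j"
    and fin: "\<And>i u. u \<in> U \<Longrightarrow> \<exists>j. f (xp i, u) $ j \<noteq> -\<infinity>"
  shows "finite_rows (G_s \<gamma> U xp r f)"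
  unfolding finite_rows_def
proof (intro conjI allI)
  fix i j
  obtain u where u: "u \<in> U" "\<forall>up\<in>U. f (xp i, up) $ j \<le> f (xp i, u) $ j"
    using att by blast
  then have "(SUP up\<in>U. f (xp i, up) $ j) = f (xp i, u) $ j"
    by (intro antisym SUP_least SUP_upper) auto
  then show "G_s \<gamma> U xp r f $ i $ j \<noteq> \<infinity>"
    using ninf[OF u(1), of i j] \<open>0 < \<gamma>\<close>
    by (cases "f (xp i, u) $ j") (auto simp: G_s_def emp_bellman_def)
next
  fix i
  obtain u where u: "u \<in> U"
    using \<open>U \<noteq> {}\<close> by blast
  then obtain j where j: "f (xp i, u) $ j \<noteq> -\<infinity>"
    using fin by blast
  have "f (xp i, u) $ j \<le> (SUP up\<in>U. f (xp i, up) $ j)"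
    using u by (rule SUP_upper)
  with j have "(SUP up\<in>U. f (xp i, up) $ j) \<noteq> -\<infinity>"
    by auto
  then have "G_s \<gamma> U xp r f $ i $ j \<noteq> -\<infinity>"
    using \<open>0 < \<gamma>\<close>
    by (cases "SUP up\<in>U. f (xp i, up) $ j") (auto simp: G_s_def emp_bellman_def)
  then show "\<exists>j. G_s \<gamma> U xp r f $ i $ j \<noteq> -\<infinity>" ..
qed

theorem theorem4p4:
  fixes X :: "(real^'dx) set" and U :: "(real^'du) set"
    and \<gamma> :: real
    and f :: "(real^'dx) \<times> (real^'du) \<Rightarrow> ereal^'p"
    and h :: "(real^'dx) \<times> (real^'du) \<Rightarrow> ereal^'q"
    and z :: "'n::finite \<Rightarrow> (real^'dx) \<times> (real^'du)"
    and xp :: "'n \<Rightarrow> real^'dx"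
    and r :: "'n \<Rightarrow> real"
  assumes "X \<noteq> {}" and "U \<noteq> {}"
    and "0 < \<gamma>" and "\<gamma> < 1"
    and "\<And>i. z i \<in> X \<times> U"
    and "\<And>i. xp i \<in> X"
    and "\<And>w j. w \<in> X \<times> U \<Longrightarrow> f w $ j \<noteq> \<infinity>"
    and "\<And>w k. w \<in> X \<times> U \<Longrightarrow> h w $ k \<noteq> \<infinity>"
    and "\<And>i j. \<exists>u\<in>U. \<forall>up\<in>U. f (xp i, up) $ j \<le> f (xp i, u) $ j"
    and "\<And>w. w \<in> X \<times> U \<Longrightarrow> \<exists>j. f w $ j \<noteq> -\<infinity>"
    and "\<And>j. \<exists>i. f (z i) $ j \<noteq> -\<infinity>"
    and "\<And>w. w \<in> X \<times> U \<Longrightarrow> \<exists>k. h w $ k \<noteq> -\<infinity>"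
    and "\<And>k. \<exists>i. h (z i) $ k \<noteq> -\<infinity>"
  shows "\<exists>D :: real^'p \<Rightarrow> real^'p.
           (\<forall>\<theta>. ereal_vec (D \<theta>) = DH \<gamma> U f h z xp r \<theta>) \<and>
           (\<forall>\<theta>1 \<theta>2. infnorm (D \<theta>1 - D \<theta>2) \<le> \<gamma> * infnorm (\<theta>1 - \<theta>2))"
proof -
  have f_ninf: "f (z i) $ j \<noteq> \<infinity>" and h_ninf: "h (z i) $ k \<noteq> \<infinity>" for i j k
    by (rule assms(7)[OF assms(5)], rule assms(8)[OF assms(5)])
  have H: "finite_rows (H_s h z)" and HT: "finite_rows (transpose (H_s h z))"
    using h_ninf assms(12)[OF assms(5)] assms(13)
    by (simp_all add: finite_rows_def H_s_def transpose_def)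
  have FT: "finite_rows (transpose (F_s f z))"
    using f_ninf assms(11) by (simp add: finite_rows_def F_s_def transpose_def)
  have G: "finite_rows (G_s \<gamma> U xp r f)"
  proof (rule finite_rows_G_s)
    show "f (xp i, u) $ j \<noteq> \<infinity>" if "u \<in> U" for i u j
      using that assms(6) by (intro assms(7)) simp
    show "\<exists>j. f (xp i, u) $ j \<noteq> -\<infinity>" if "u \<in> U" for i u
      using that assms(6) by (intro assms(10)) simp
  qed (fact assms)+
  define A where "A = GH_s \<gamma> U f h z xp r"
  define B where "B = transpose (FH_s f h z)"
  have A: "finite_rows A"
    unfolding A_def GH_s_def by (rule finite_rows_mp_mult[OF HT G])
  have B: "finite_rows B"
    unfolding B_def FH_s_def transpose_mp_mult transpose_transpose
    by (rule finite_rows_mp_mult[OF FT H])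
  define D where "D \<theta> = - mp_apply B (- mp_apply A (\<gamma> *\<^sub>R \<theta>))" for \<theta> :: "real^'p"
  have "ereal_vec (D \<theta>) = DH \<gamma> U f h z xp r \<theta>" for \<theta>
    by (simp add: D_def DH_def ereal_vec_uminus ereal_vec_mp_apply[OF A] ereal_vec_mp_apply[OF B]
        flip: A_def B_def)
  moreover have "infnorm (D \<theta>1 - D \<theta>2) \<le> \<gamma> * infnorm (\<theta>1 - \<theta>2)" for \<theta>1 \<theta>2
  proof -
    define a1 where "a1 = mp_apply A (\<gamma> *\<^sub>R \<theta>1)"
    define a2 where "a2 = mp_apply A (\<gamma> *\<^sub>R \<theta>2)"
    have "infnorm (D \<theta>1 - D \<theta>2) = infnorm (mp_apply B (- a1) - mp_apply B (- a2))"
      by (simp add: D_def a1_def a2_def infnorm_sub)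
    also have "\<dots> \<le> infnorm (- a1 - - a2)"
      by (rule infnorm_mp_apply_diff_le[OF B])
    also have "\<dots> = infnorm (a1 - a2)"
      by (simp add: infnorm_sub)
    also have "\<dots> \<le> infnorm (\<gamma> *\<^sub>R \<theta>1 - \<gamma> *\<^sub>R \<theta>2)"
      unfolding a1_def a2_def by (rule infnorm_mp_apply_diff_le[OF A])
    also have "\<dots> = \<gamma> * infnorm (\<theta>1 - \<theta>2)"
      using \<open>0 < \<gamma>\<close> by (simp add: infnorm_mul flip: scaleR_diff_right)
    finally show ?thesis .
  qed
  ultimately show ?thesis by blast
qed

end
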